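(* (Holevo bound for QIFS.) Let $V_i,W_i$, $i=1,\dots,k$, be linear operators on $\mathbb{C}^N$ with $\sum_{i=1}^kW_i^*W_i=I$, and let $\mathcal{F}$ be the QIFS they induce. Suppose there is a unique attractive invariant measure for the Markov operator $\mathcal{V}$ associated to $\mathcal{F}$, and let $\rho_W$ be its barycenter. For $i=1,\dots,k$ let $p_i=\mathrm{tr}(W_i\rho_WW_i^* )$ and $$\rho_i=\sum_{j=1}^k a_{ij}(\rho_W)\,|j\rangle\langle j|,\qquad a_{ij}(\rho)=\frac{\mathrm{tr}(W_jV_i\rho V_i^*W_j^* )}{\mathrm{tr}(V_i\rho V_i^* )}.$$ Suppose a mixed state $\rho_X$ is chosen from the ensemble $\{\rho_1,\dots,\rho_k\}$ with probabilities $\{p_1,\dots,p_k\}$ (that is, $\rho_X$ is determined by a random variable $X$ and equals $\rho_i$ with probability $p_i$), and that a POVM measurement with POVM elements $\{P_l\}_{l=1,\dots,m}$ is performed on that state, with measurement outcome described by a random variable $Y$. Then, writing $\rho=\sum_{i=1}^k p_i\rho_i$, $$I(X:Y)\le S(\rho)-h_V(W).$$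
   Context: $\mathcal{M}_N$ is the set of density matrices on $\mathbb{C}^N$ (positive semidefinite, trace $1$); $\mathcal{M}^1(\mathcal{M}_N)$ is the set of Borel probability measures on it. The QIFS induced by $V_i,W_i$ is $\mathcal{F}=\{\mathcal{M}_N,F_i,p_i(\cdot)\}_{i=1,\dots,k}$ with $F_i(\rho)=V_i\rho V_i^*/\mathrm{tr}(V_i\rho V_i^* )$ and $p_i(\rho)=\mathrm{tr}(W_i\rho W_i^* )$, the $V_i$ being such that $F_i:\mathcal{M}_N\to\mathcal{M}_N$ is well defined. Its Markov operator on $\mathcal{M}^1(\mathcal{M}_N)$ is $(\mathcal{V}\nu)(B)=\sum_{i=1}^k\int_{F_i^{-1}(B)}p_i\,d\nu$. A measure $\mu$ is invariant if $\mathcal{V}\mu=\mu$, and attractive if $\mathcal{V}^n\nu\to\mu$ weakly for every $\nu\in\mathcal{M}^1(\mathcal{M}_N)$; its barycenter is $\int_{\mathcal{M}_N}\rho\,d\mu(\rho)$. The QIFS entropy is $$h_V(W)=-\sum_{i,j=1}^k\mathrm{tr}(W_i\rho_WW_i^* )\,a_{ij}(\rho_W)\log a_{ij}(\rho_W),\qquad 0\log0=0.$$ The vectors $|1\rangle,\dots,|k\rangle$ are an orthonormal basis of $\mathbb{C}^k$, so each $\rho_i$ is a density matrix on $\mathbb{C}^k$. $S(\rho)=-\mathrm{tr}(\rho\log\rho)$ is the von Neumann entropy. A POVM is a finite set of positive semidefinite operators $P_l$ (here on $\mathbb{C}^k$) with $\sum_lP_l=I$; measured on a state $\sigma$, the outcome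 is $l$ with probability $\mathrm{tr}(P_l\sigma)$, so the joint distribution is $\Pr(X=i,Y=l)=p_i\,\mathrm{tr}(P_l\rho_i)$. The mutual information is $I(X:Y)=H(X)+H(Y)-H(X,Y)$ with $H$ the Shannon entropy and $H(X,Y)$ the joint Shannon entropy. All logarithms have the same base. *)

theory Defs
  imports "HOL-Probability.Probability"
begin

section \<open>Operators on a finite-dimensional Hilbert space\<close>

text \<open>Operators on the \<open>CARD('n)\<close>-dimensional complex Hilbert space are matrices of type
  \<open>complex ^ 'n ^ 'n\<close>. The constant \<open>adjoint\<close> of the library is taken with respect to the real
  inner product of a Euclidean space, hence a separate constant for the Hermitian adjoint.\<close>

definition cadj :: "complex ^ 'n ^ 'm \<Rightarrow> complex ^ 'm ^ 'n" where
  "cadj A = (\<chi> i j. cnj (A $ j $ i))"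

definition cinner :: "complex ^ 'n \<Rightarrow> complex ^ 'n \<Rightarrow> complex" where
  "cinner x y = (\<Sum>i\<in>UNIV. cnj (x $ i) * y $ i)"

definition ketbra :: "complex ^ 'n \<Rightarrow> complex ^ 'n \<Rightarrow> complex ^ 'n ^ 'n" where
  "ketbra x y = (\<chi> i j. x $ i * cnj (y $ j))"

definition orthonormal_family :: "('k \<Rightarrow> complex ^ 'n) \<Rightarrow> bool" where
  "orthonormal_family e \<longleftrightarrow> (\<forall>i j. cinner (e i) (e j) = (if i = j then 1 else 0))"

definition psd :: "complex ^ 'n ^ 'n \<Rightarrow> bool" where
  "psd A \<longleftrightarrow> cadj A = A \<and> (\<forall>x. 0 \<le> Re (cinner x (A *v x)))"

definition density_ops :: "(complex ^ 'n ^ 'n) set" where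
  "density_ops = {\<rho>. psd \<rho> \<and> trace \<rho> = 1}"

definition povm :: "('m::finite \<Rightarrow> complex ^ 'n ^ 'n) \<Rightarrow> bool" where
  "povm P \<longleftrightarrow> (\<forall>l. psd (P l)) \<and> (\<Sum>l\<in>UNIV. P l) = mat 1"

definition diag_real :: "('n \<Rightarrow> real) \<Rightarrow> complex ^ 'n ^ 'n" where
  "diag_real d = (\<chi> i j. if i = j then complex_of_real (d i) else 0)"

text \<open>Functional calculus for Hermitian matrices: if \<open>A = U diag(d) U\<^sup>*\<close> with \<open>U\<close> unitary, then
  \<open>f(A) = U diag(f \<circ> d) U\<^sup>*\<close>, independently of the diagonalization chosen.\<close>

definition herm_fun :: "(real \<Rightarrow> real) \<Rightarrow> complex ^ 'n ^ 'n \<Rightarrow> complex ^ 'n ^ 'n" where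
  "herm_fun f A = (THE B. \<exists>(U :: complex ^ 'n ^ 'n) (d :: 'n \<Rightarrow> real).
         cadj U ** U = mat 1 \<and> A = U ** diag_real d ** cadj U
                               \<and> B = U ** diag_real (f \<circ> d) ** cadj U)"

lemma diag_real_mult_nth:
  "(M ** diag_real d) $ i $ j = M $ i $ j * complex_of_real (d j)"
  "(diag_real d ** M) $ i $ j = complex_of_real (d i) * M $ i $ j"
  by (simp_all add: matrix_matrix_mult_def diag_real_def if_distrib if_distribR cong: if_cong)

lemma herm_fun_unitary_diag:
  fixes U :: "complex ^ 'n::finite ^ 'n"
  assumes U: "cadj U ** U = mat 1"
  shows "herm_fun f (U ** diag_real d ** cadj U) = U ** diag_real (f \<circ> d) ** cadj U"
  unfolding herm_fun_def
proof (rule the_equality)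
  show "\<exists>(U' :: complex ^ 'n ^ 'n) d'. cadj U' ** U' = mat 1 \<and> U ** diag_real d ** cadj U = U' ** diag_real d' ** cadj U' \<and>
     U ** diag_real (f \<circ> d) ** cadj U = U' ** diag_real (f \<circ> d') ** cadj U'"
    using U by blast
next
  fix B
  assume "\<exists>(U' :: complex ^ 'n ^ 'n) d'. cadj U' ** U' = mat 1 \<and> U ** diag_real d ** cadj U = U' ** diag_real d' ** cadj U' \<and>
     B = U' ** diag_real (f \<circ> d') ** cadj U'"
  then obtain U' :: "complex ^ 'n ^ 'n" and d' where U': "cadj U' ** U' = mat 1"
    and eq: "U ** diag_real d ** cadj U = U' ** diag_real d' ** cadj U'"
    and B: "B = U' ** diag_real (f \<circ> d') ** cadj U'" by blast
  have UU: "U ** cadj U = mat 1" and UU': "U' ** cadj U' = mat 1"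
    using U U' matrix_left_right_inverse by blast+
  define M where "M = cadj U' ** U"
  have "cadj U' ** (U ** diag_real d ** cadj U) ** U = cadj U' ** (U' ** diag_real d' ** cadj U') ** U"
    by (simp only: eq)
  moreover have "cadj U' ** (U ** diag_real d ** cadj U) ** U = M ** diag_real d ** (cadj U ** U)"
    by (simp add: M_def matrix_mul_assoc)
  moreover have "cadj U' ** (U' ** diag_real d' ** cadj U') ** U = (cadj U' ** U') ** diag_real d' ** M"
    by (simp add: M_def matrix_mul_assoc)
  ultimately have M: "M ** diag_real d = diag_real d' ** M"
    by (simp add: U U')
  have "(M ** diag_real (f \<circ> d)) $ i $ j = (diag_real (f \<circ> d') ** M) $ i $ j" for i j
  proof -
    have "M $ i $ j * complex_of_real (d j) = complex_of_real (d' i) * M $ i $ j"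
      using M by (metis diag_real_mult_nth)
    then have "M $ i $ j = 0 \<or> d j = d' i" by auto
    then show ?thesis by (auto simp: diag_real_mult_nth)
  qed
  then have Mf: "M ** diag_real (f \<circ> d) = diag_real (f \<circ> d') ** M"
    by (simp add: vec_eq_iff)
  have "U' ** (M ** diag_real (f \<circ> d)) ** cadj U = U' ** (diag_real (f \<circ> d') ** M) ** cadj U"
    by (simp only: Mf)
  moreover have "U' ** (M ** diag_real (f \<circ> d)) ** cadj U = (U' ** cadj U') ** U ** diag_real (f \<circ> d) ** cadj U"
    by (simp add: M_def matrix_mul_assoc)
  moreover have "U' ** (diag_real (f \<circ> d') ** M) ** cadj U = U' ** diag_real (f \<circ> d') ** cadj U' ** (U ** cadj U)"
    by (simp add: M_def matrix_mul_assoc)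
  ultimately show "B = U ** diag_real (f \<circ> d) ** cadj U"
    by (simp add: UU UU' B)
qed

text \<open>Since \<open>log b 0 = 0\<close> in the library, the kernel of \<open>\<rho>\<close> contributes \<open>0\<close>; this is the convention
  \<open>0 log 0 = 0\<close>.\<close>

definition von_neumann_entropy :: "real \<Rightarrow> complex ^ 'n ^ 'n \<Rightarrow> real" where
  "von_neumann_entropy b \<rho> = - Re (trace (\<rho> ** herm_fun (log b) \<rho>))"


section \<open>Quantum iterated function systems\<close>

text \<open>The traces below are real and nonnegative on density matrices, so taking real parts loses
  nothing.\<close>

definition tr_conj :: "complex ^ 'n ^ 'n \<Rightarrow> complex ^ 'n ^ 'n \<Rightarrow> real" where
  "tr_conj A \<rho> = Re (trace (A ** \<rho> ** cadj A))"

definition qifs_map ::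
  "('k \<Rightarrow> complex ^ 'n ^ 'n) \<Rightarrow> 'k \<Rightarrow> complex ^ 'n ^ 'n \<Rightarrow> complex ^ 'n ^ 'n" where
  "qifs_map V i \<rho> = (1 / tr_conj (V i) \<rho>) *\<^sub>R (V i ** \<rho> ** cadj (V i))"

definition qifs_prob :: "('k \<Rightarrow> complex ^ 'n ^ 'n) \<Rightarrow> 'k \<Rightarrow> complex ^ 'n ^ 'n \<Rightarrow> real" where
  "qifs_prob W i \<rho> = tr_conj (W i) \<rho>"

definition qifs_well_defined :: "('k \<Rightarrow> complex ^ 'n ^ 'n) \<Rightarrow> bool" where
  "qifs_well_defined V \<longleftrightarrow>
     (\<forall>i. \<forall>\<rho>\<in>density_ops. trace (V i ** \<rho> ** cadj (V i)) \<noteq> 0 \<and> qifs_map V i \<rho> \<in> density_ops)"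

definition prob_measures_on_density_ops :: "(complex ^ 'n ^ 'n) measure set" where
  "prob_measures_on_density_ops =
     {\<nu>. prob_space \<nu> \<and> sets \<nu> = sets (restrict_space borel density_ops)}"

definition markov_op ::
  "('k::finite \<Rightarrow> complex ^ 'n ^ 'n) \<Rightarrow> ('k \<Rightarrow> complex ^ 'n ^ 'n)
    \<Rightarrow> (complex ^ 'n ^ 'n) measure \<Rightarrow> (complex ^ 'n ^ 'n) measure" where
  "markov_op V W \<nu> =
     measure_of density_ops (sets (restrict_space borel density_ops))
       (\<lambda>B. \<Sum>i\<in>UNIV. \<integral>\<^sup>+\<rho>\<in>{\<rho>\<in>density_ops. qifs_map V i \<rho> \<in> B}. ennreal (qifs_prob W i \<rho>) \<partial>\<nu>)"

lemma continuous_tr_conj: "continuous_on S (tr_conj A)"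
  unfolding tr_conj_def trace_def matrix_matrix_mult_def
  by (intro continuous_intros)

lemma measurable_qifs_map:
  fixes V :: "'k \<Rightarrow> complex ^ 'n::finite ^ 'n"
  shows
  "qifs_map V i \<in> borel \<rightarrow>\<^sub>M borel"
proof -
  have 1: "continuous_on UNIV (\<lambda>\<rho>. V i ** \<rho> ** cadj (V i))"
    unfolding matrix_matrix_mult_def by (intro continuous_intros)
  show ?thesis unfolding qifs_map_def
    by (intro borel_measurable_scaleR borel_measurable_divide borel_measurable_const
        borel_measurable_continuous_onI 1 continuous_tr_conj)
qed


lemma emeasure_markov_op:
  fixes V W :: "'k::finite \<Rightarrow> complex ^ 'n::finite ^ 'n"
  assumes V: "qifs_well_defined V" and \<nu>: "\<nu> \<in> prob_measures_on_density_ops"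
    and B: "B \<in> sets (restrict_space borel density_ops)"
  shows "emeasure (markov_op V W \<nu>) B =
    (\<Sum>i\<in>UNIV. \<integral>\<^sup>+\<rho>\<in>{\<rho>\<in>density_ops. qifs_map V i \<rho> \<in> B}. ennreal (qifs_prob W i \<rho>) \<partial>\<nu>)"
proof (rule emeasure_measure_of[OF markov_op_def])
  let ?D = "density_ops :: (complex ^ 'n ^ 'n) set"
  let ?R = "restrict_space borel ?D"
  let ?p = "\<lambda>i \<rho>. ennreal (qifs_prob W i \<rho>)"
  let ?pre = "\<lambda>i B. {\<rho>\<in>?D. qifs_map V i \<rho> \<in> B}"
  let ?\<mu> = "\<lambda>B. \<Sum>i\<in>UNIV. \<integral>\<^sup>+\<rho>\<in>?pre i B. ?p i \<rho> \<partial>\<nu>"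
  have sets: "sets \<nu> = sets ?R" using \<nu> by (simp add: prob_measures_on_density_ops_def)
  have space: "space \<nu> = ?D" using sets_eq_imp_space_eq[OF sets] by (simp add: space_restrict_space)
  show sub: "sets ?R \<subseteq> Pow ?D" using sets.space_closed[of ?R] by (simp add: space_restrict_space)
  have sm: "sets (markov_op V W \<nu>) = sets ?R"
    unfolding markov_op_def using sets.sets_measure_of_eq[of ?R] by (simp add: space_restrict_space)
  show "B \<in> sets (markov_op V W \<nu>)" using B sm by simp
  show "positive (sets (markov_op V W \<nu>)) ?\<mu>" by (simp add: positive_def)
  have idm: "(\<lambda>x. x) \<in> \<nu> \<rightarrow>\<^sub>M borel"
    using measurable_restrict_space1[of "\<lambda>x. x" borel borel ?D] measurable_cong_sets[OF sets refl] by auto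
  have fm: "qifs_map V i \<in> \<nu> \<rightarrow>\<^sub>M borel" for i
    using measurable_compose[OF idm measurable_qifs_map[of V i]] by simp
  have pm: "?p i \<in> borel_measurable \<nu>" for i
    using measurable_compose[OF idm borel_measurable_continuous_onI[OF continuous_tr_conj[of UNIV "W i"]]]
    by (simp add: qifs_prob_def)
  have pre: "?pre i A \<in> sets \<nu>" if "A \<in> sets ?R" for A i
  proof -
    obtain A' where A': "A' \<in> sets borel" "A = A' \<inter> ?D"
      using \<open>A \<in> sets ?R\<close> by (auto simp: sets_restrict_space)
    have "?pre i A = qifs_map V i -` A' \<inter> space \<nu>"
      using V by (auto simp: space A' qifs_well_defined_def)
    then show ?thesis using measurable_sets[OF fm[of i] A'(1)] by simp
  qed
  show "countably_additive (sets (markov_op V W \<nu>)) ?\<mu>"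
    unfolding sm
  proof (rule countably_additiveI)
    fix A :: "nat \<Rightarrow> (complex ^ 'n ^ 'n) set"
    assume A: "range A \<subseteq> sets ?R" "disjoint_family A" "(\<Union>i. A i) \<in> sets ?R"
    have e: "(\<integral>\<^sup>+\<rho>\<in>?pre i C. ?p i \<rho> \<partial>\<nu>) = emeasure (density \<nu> (?p i)) (?pre i C)"
      if "C \<in> sets ?R" for C i
      using pre[OF that] pm by (simp add: emeasure_density)
    have "(\<Sum>n. ?\<mu> (A n)) = (\<Sum>n. \<Sum>i\<in>UNIV. emeasure (density \<nu> (?p i)) (?pre i (A n)))"
      using A(1) by (intro suminf_cong sum.cong refl e) auto
    also have "\<dots> = (\<Sum>i\<in>UNIV. \<Sum>n. emeasure (density \<nu> (?p i)) (?pre i (A n)))"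
      by (intro suminf_sum) auto
    also have "\<dots> = (\<Sum>i\<in>UNIV. emeasure (density \<nu> (?p i)) (\<Union>n. ?pre i (A n)))"
    proof (intro sum.cong refl suminf_emeasure)
      fix i
      show "range (\<lambda>n. ?pre i (A n)) \<subseteq> sets (density \<nu> (?p i))" using pre A(1) by auto
      show "disjoint_family (\<lambda>n. ?pre i (A n))" using A(2) by (auto simp: disjoint_family_on_def)
    qed
    also have "\<dots> = (\<Sum>i\<in>UNIV. emeasure (density \<nu> (?p i)) (?pre i (\<Union>n. A n)))"
      by (intro sum.cong refl arg_cong2[where f=emeasure]) auto
    also have "\<dots> = ?\<mu> (\<Union>n. A n)" using e[OF A(3)] by simp
    finally show "(\<Sum>n. ?\<mu> (A n)) = ?\<mu> (\<Union>n. A n)" .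
  qed
qed

definition weakly_converges ::
  "(nat \<Rightarrow> (complex ^ 'n ^ 'n) measure) \<Rightarrow> (complex ^ 'n ^ 'n) measure \<Rightarrow> bool" where
  "weakly_converges \<nu> \<mu> \<longleftrightarrow>
     (\<forall>f :: complex ^ 'n ^ 'n \<Rightarrow> real.
        continuous_on density_ops f \<and> bounded (f ` density_ops) \<longrightarrow>
        (\<lambda>n. \<integral>\<rho>. f \<rho> \<partial>\<nu> n) \<longlonglongrightarrow> (\<integral>\<rho>. f \<rho> \<partial>\<mu>))"

definition attractive_invariant ::
  "('k::finite \<Rightarrow> complex ^ 'n ^ 'n) \<Rightarrow> ('k \<Rightarrow> complex ^ 'n ^ 'n)
    \<Rightarrow> (complex ^ 'n ^ 'n) measure \<Rightarrow> bool" where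
  "attractive_invariant V W \<mu> \<longleftrightarrow>
     \<mu> \<in> prob_measures_on_density_ops \<and> markov_op V W \<mu> = \<mu> \<and>
     (\<forall>\<nu>\<in>prob_measures_on_density_ops. weakly_converges (\<lambda>n. (markov_op V W ^^ n) \<nu>) \<mu>)"

definition barycenter :: "(complex ^ 'n ^ 'n) measure \<Rightarrow> complex ^ 'n ^ 'n" where
  "barycenter \<mu> = (\<integral>\<rho>. \<rho> \<partial>\<mu>)"

definition qifs_trans ::
  "('k \<Rightarrow> complex ^ 'n ^ 'n) \<Rightarrow> ('k \<Rightarrow> complex ^ 'n ^ 'n) \<Rightarrow> 'k \<Rightarrow> 'k \<Rightarrow> complex ^ 'n ^ 'n \<Rightarrow> real" where
  "qifs_trans V W i j \<rho> =
     Re (trace (W j ** V i ** \<rho> ** cadj (V i) ** cadj (W j))) / tr_conj (V i) \<rho>"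

text \<open>The entropy \<open>h\<^sub>V(W)\<close> is the value at the barycenter \<open>\<rho>\<^sub>W\<close> of the attractive invariant
  measure.\<close>

definition qifs_entropy ::
  "real \<Rightarrow> ('k::finite \<Rightarrow> complex ^ 'n ^ 'n) \<Rightarrow> ('k \<Rightarrow> complex ^ 'n ^ 'n) \<Rightarrow> complex ^ 'n ^ 'n \<Rightarrow> real" where
  "qifs_entropy b V W \<rho>\<^sub>W =
     - (\<Sum>i\<in>UNIV. \<Sum>j\<in>UNIV.
          tr_conj (W i) \<rho>\<^sub>W * (qifs_trans V W i j \<rho>\<^sub>W * log b (qifs_trans V W i j \<rho>\<^sub>W)))"


section \<open>Shannon entropies of finite-valued random variables\<close>

text \<open>With respect to counting measure, the entropy of the library is the Shannon entropy to the
  base \<open>b\<close>. Its \<open>mutual_information\<close> is a divergence; here the defining formula is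
  \<open>H(X) + H(Y) - H(X,Y)\<close>.\<close>

definition shannon_entropy :: "real \<Rightarrow> 'w measure \<Rightarrow> ('w \<Rightarrow> 'a) \<Rightarrow> real" where
  "shannon_entropy b M X = prob_space.entropy M b (count_space (X ` space M)) X"

definition shannon_mutual_info :: "real \<Rightarrow> 'w measure \<Rightarrow> ('w \<Rightarrow> 'a) \<Rightarrow> ('w \<Rightarrow> 'b) \<Rightarrow> real" where
  "shannon_mutual_info b M X Y =
     shannon_entropy b M X + shannon_entropy b M Y - shannon_entropy b M (\<lambda>\<omega>. (X \<omega>, Y \<omega>))"

text \<open>\<open>X\<close> selects a state of the ensemble \<open>{(p i, \<sigma> i)}\<close>, and \<open>Y\<close> is the outcome of the
  measurement \<open>P\<close> on the selected state: \<open>Pr(Y = l | X = i) = tr(P\<^sub>l \<sigma>\<^sub>i)\<close>. The law is stated jointly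
  because \<open>p i\<close> may vanish.\<close>

definition measured_ensemble ::
  "'w measure \<Rightarrow> ('w \<Rightarrow> 'k) \<Rightarrow> ('w \<Rightarrow> 'm) \<Rightarrow> ('k \<Rightarrow> real) \<Rightarrow> ('k \<Rightarrow> complex ^ 'n ^ 'n)
    \<Rightarrow> ('m \<Rightarrow> complex ^ 'n ^ 'n) \<Rightarrow> bool" where
  "measured_ensemble M X Y p \<sigma> P \<longleftrightarrow>
     prob_space M \<and> X \<in> M \<rightarrow>\<^sub>M count_space UNIV \<and> Y \<in> M \<rightarrow>\<^sub>M count_space UNIV \<and>
     (\<forall>i. measure M {\<omega>\<in>space M. X \<omega> = i} = p i) \<and>
     (\<forall>i l. measure M {\<omega>\<in>space M. X \<omega> = i \<and> Y \<omega> = l} = p i * Re (trace (P l ** \<sigma> i)))"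

end

theory Submission
  imports Defs
begin

text \<open>All states \<open>\<sigma> i\<close> are diagonal in the basis \<open>e\<close>, so the quantum bound reduces to classical
  data processing along the Markov chain \<open>X \<rightarrow> J \<rightarrow> Y\<close>, where \<open>J\<close> has conditional law
  \<open>a\<^sub>i\<^sub>j\<close> given \<open>X = i\<close> and \<open>Y\<close> has conditional law \<open>\<langle>e\<^sub>j, P\<^sub>l e\<^sub>j\<rangle>\<close> given \<open>J = j\<close>: the right-hand
  side of the bound is \<open>I(X:J)\<close>. The inequality \<open>I(X:Y) \<le> I(X:J)\<close> follows from \<open>ln x \<le> x - 1\<close>
  applied to each triple \<open>(i, j, l)\<close>.\<close>

section \<open>Adjoints, traces and positivity\<close>

lemma cadj_matrix_mul: "cadj (A ** B) = cadj B ** cadj A"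
  by (simp add: cadj_def matrix_matrix_mult_def vec_eq_iff mult.commute)

lemma linear_cadj: "linear (cadj :: complex ^ 'n ^ 'm \<Rightarrow> _)"
  by (rule linearI) (simp_all add: cadj_def vec_eq_iff)

lemma linear_Re_cinner_matrix: "linear (\<lambda>A. Re (cinner x (A *v y)))"
  by (rule linearI)
    (simp_all add: cinner_def matrix_vector_mult_def algebra_simps sum.distrib sum_distrib_left)

lemma Re_trace_sum: "Re (trace (\<Sum>i\<in>I. A i)) = (\<Sum>i\<in>I. Re (trace (A i)))"
  by (induction I rule: infinite_finite_induct) (simp_all add: trace_def sum.distrib)

lemma matrix_mul_sum_left: "(\<Sum>i\<in>I. A i) ** B = (\<Sum>i\<in>I. A i ** B)"
  by (induction I rule: infinite_finite_induct)
    (simp_all add: vec_eq_iff matrix_matrix_mult_def distrib_right sum.distrib)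

text \<open>Each diagonal entry of \<open>A ** \<rho> ** cadj A\<close> is the quadratic form of
  \<open>\<rho>\<close> at the conjugate of the corresponding row of \<open>A\<close>.\<close>

lemma tr_conj_nonneg:
  assumes "psd \<rho>"
  shows "0 \<le> tr_conj A \<rho>"
proof -
  have "trace (A ** \<rho> ** cadj A) =
      (\<Sum>i\<in>UNIV. cinner (\<chi> j. cnj (A $ i $ j)) (\<rho> *v (\<chi> j. cnj (A $ i $ j))))"
    unfolding matrix_mul_assoc[symmetric]
    by (simp add: trace_def matrix_matrix_mult_def matrix_vector_mult_def cinner_def cadj_def)
  then show ?thesis
    using assms by (simp add: tr_conj_def psd_def sum_nonneg)
qed

text \<open>Cyclicity of the trace brings \<open>cadj (W i)\<close> next to \<open>W i\<close>, so
  the completeness relation applies.\<close>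

lemma sum_tr_conj:
  fixes W :: "'k::finite \<Rightarrow> complex ^ 'n::finite ^ 'n"
  assumes "(\<Sum>i\<in>UNIV. cadj (W i) ** W i) = mat 1"
  shows "(\<Sum>i\<in>UNIV. tr_conj (W i) \<rho>) = Re (trace \<rho>)"
proof -
  have "trace (W i ** \<rho> ** cadj (W i)) = trace (cadj (W i) ** W i ** \<rho>)" for i
    by (subst trace_mul_sym) (simp add: matrix_mul_assoc)
  then have "(\<Sum>i\<in>UNIV. tr_conj (W i) \<rho>) = Re (trace ((\<Sum>i\<in>UNIV. cadj (W i) ** W i) ** \<rho>))"
    by (simp add: tr_conj_def matrix_mul_sum_left Re_trace_sum)
  then show ?thesis
    by (simp add: assms)
qed

section \<open>Positivity of the barycenter and of the transition weights\<close>

text \<open>Both the adjoint and the quadratic form at a fixed vector are real-linear in finite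
  dimension, hence bounded, and commute with the integral.\<close>

lemma psd_barycenter:
  assumes \<nu>: "\<nu> \<in> prob_measures_on_density_ops" and int: "integrable \<nu> (\<lambda>\<rho>. \<rho>)"
  shows "psd (barycenter \<nu>)"
proof -
  have "space \<nu> = density_ops"
    using \<nu> sets_eq_imp_space_eq[of \<nu> "restrict_space borel density_ops"]
    by (auto simp: prob_measures_on_density_ops_def space_restrict_space)
  then have psd: "psd \<rho>" if "\<rho> \<in> space \<nu>" for \<rho>
    using that by (simp add: density_ops_def)
  have "cadj (barycenter \<nu>) = (\<integral>\<rho>. cadj \<rho> \<partial>\<nu>)"
    unfolding barycenter_def using linear_cadj int
    by (intro integral_bounded_linear[symmetric]) (simp_all add: linear_conv_bounded_linear)
  also have "\<dots> = barycenter \<nu>"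
    unfolding barycenter_def using psd by (intro Bochner_Integration.integral_cong) (auto simp: psd_def)
  finally have herm: "cadj (barycenter \<nu>) = barycenter \<nu>" .
  have "0 \<le> Re (cinner x (barycenter \<nu> *v x))" for x
  proof -
    have "Re (cinner x (barycenter \<nu> *v x)) = (\<integral>\<rho>. Re (cinner x (\<rho> *v x)) \<partial>\<nu>)"
      unfolding barycenter_def using linear_Re_cinner_matrix[of x x] int
      by (intro integral_bounded_linear[symmetric]) (simp_all add: linear_conv_bounded_linear)
    also have "0 \<le> \<dots>"
      using psd by (intro Bochner_Integration.integral_nonneg) (auto simp: psd_def)
    finally show ?thesis .
  qed
  with herm show ?thesis
    by (simp add: psd_def)
qed

lemma qifs_trans_eq: "qifs_trans V W i j \<rho> = tr_conj (W j) (V i ** \<rho> ** cadj (V i)) / tr_conj (V i) \<rho>"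
  by (simp add: qifs_trans_def tr_conj_def matrix_mul_assoc)

text \<open>The numerator is a conjugation by the single operator \<open>W j ** V i\<close>. A
  vanishing denominator is harmless, since division by zero gives 0.\<close>

lemma qifs_trans_nonneg:
  assumes "psd \<rho>"
  shows "0 \<le> qifs_trans V W i j \<rho>"
proof -
  have "tr_conj (W j) (V i ** \<rho> ** cadj (V i)) = tr_conj (W j ** V i) \<rho>"
    by (simp add: tr_conj_def cadj_matrix_mul matrix_mul_assoc)
  then show ?thesis
    using assms by (simp add: qifs_trans_eq tr_conj_nonneg)
qed

section \<open>States diagonal in an orthonormal basis\<close>

definition basis_matrix :: "('k \<Rightarrow> complex ^ 'n) \<Rightarrow> complex ^ 'k ^ 'n" where
  "basis_matrix e = (\<chi> i j. e j $ i)"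

lemma basis_matrix_unitary:
  "orthonormal_family e \<Longrightarrow> cadj (basis_matrix e) ** basis_matrix e = mat 1"
  by (simp add: orthonormal_family_def basis_matrix_def cadj_def matrix_matrix_mult_def mat_def
      cinner_def vec_eq_iff)

text \<open>Supplies the unitary diagonalization to which \<open>herm_fun_unitary_diag\<close>
  applies.\<close>

lemma sum_ketbra_eq_diag:
  fixes e :: "'k::finite \<Rightarrow> complex ^ 'k"
  shows "(\<Sum>j\<in>UNIV. d j *\<^sub>R ketbra (e j) (e j)) = basis_matrix e ** diag_real d ** cadj (basis_matrix e)"
  by (simp add: vec_eq_iff ketbra_def basis_matrix_def cadj_def matrix_matrix_mult_def[of "_ ** _"] diag_real_mult_nth
      scaleR_conv_of_real[where 'a=complex] mult_ac)

text \<open>The logarithm acts on the eigenvalues \<open>d j\<close>, and cyclicity of the trace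
  removes the unitary.\<close>

lemma von_neumann_entropy_diag:
  fixes e :: "'k::finite \<Rightarrow> complex ^ 'k"
  assumes "orthonormal_family e"
  shows "von_neumann_entropy b (\<Sum>j\<in>UNIV. d j *\<^sub>R ketbra (e j) (e j)) = - (\<Sum>j\<in>UNIV. d j * log b (d j))"
proof -
  define U where "U = basis_matrix e"
  have U: "cadj U ** U = mat 1"
    using assms by (simp add: U_def basis_matrix_unitary)
  let ?D = "diag_real d" and ?L = "diag_real (log b \<circ> d)"
  have "trace (U ** ?D ** cadj U ** (U ** ?L ** cadj U)) = trace (U ** ?D ** (cadj U ** U) ** ?L ** cadj U)"
    by (simp add: matrix_mul_assoc)
  also have "\<dots> = trace (cadj U ** (U ** ?D ** ?L))"
    by (subst trace_mul_sym) (simp add: U)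
  also have "\<dots> = trace (?D ** ?L)"
    by (simp add: matrix_mul_assoc U)
  also have "\<dots> = (\<Sum>j\<in>UNIV. complex_of_real (d j * log b (d j)))"
    by (simp add: trace_def diag_real_mult_nth) (simp add: diag_real_def)
  finally show ?thesis
    by (simp add: von_neumann_entropy_def sum_ketbra_eq_diag herm_fun_unitary_diag[OF U] flip: U_def)
qed

text \<open>With \<open>A = P l\<close>, the Born rule averages the outcome probabilities at the
  basis vectors with weights \<open>d j\<close>. This yields the factorization through
  \<open>J\<close>.\<close>

lemma Re_trace_mul_sum_ketbra:
  fixes e :: "'k::finite \<Rightarrow> complex ^ 'n::finite"
  shows "Re (trace (A ** (\<Sum>j\<in>UNIV. d j *\<^sub>R ketbra (e j) (e j)))) =
    (\<Sum>j\<in>UNIV. d j * Re (cinner (e j) (A *v e j)))"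
proof -
  have "trace (A ** (\<Sum>j\<in>UNIV. d j *\<^sub>R ketbra (e j) (e j))) =
      (\<Sum>i\<in>UNIV. \<Sum>k\<in>UNIV. \<Sum>j\<in>UNIV. d j *\<^sub>R (cnj (e j $ i) * (A $ i $ k * e j $ k)))"
    by (simp add: trace_def matrix_matrix_mult_def ketbra_def scaleR_conv_of_real[where 'a=complex]
        sum_distrib_left mult_ac)
  also have "\<dots> = (\<Sum>i\<in>UNIV. \<Sum>j\<in>UNIV. \<Sum>k\<in>UNIV. d j *\<^sub>R (cnj (e j $ i) * (A $ i $ k * e j $ k)))"
    by (intro sum.cong refl sum.swap)
  also have "\<dots> = (\<Sum>j\<in>UNIV. \<Sum>i\<in>UNIV. \<Sum>k\<in>UNIV. d j *\<^sub>R (cnj (e j $ i) * (A $ i $ k * e j $ k)))"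
    by (rule sum.swap)
  also have "\<dots> = (\<Sum>j\<in>UNIV. d j *\<^sub>R cinner (e j) (A *v e j))"
    by (simp add: cinner_def matrix_vector_mult_def scaleR_sum_right sum_distrib_left)
  finally show ?thesis
    by simp
qed

lemma povm_distribution:
  assumes P: "povm P" and e: "orthonormal_family e"
  shows "0 \<le> Re (cinner (e j) (P l *v e j))" and "(\<Sum>l\<in>UNIV. Re (cinner (e j) (P l *v e j))) = 1"
proof -
  show "0 \<le> Re (cinner (e j) (P l *v e j))"
    using P by (simp add: povm_def psd_def)
  have "(\<Sum>l\<in>UNIV. Re (cinner (e j) (P l *v e j))) = Re (cinner (e j) ((\<Sum>l\<in>UNIV. P l) *v e j))"
    by (simp add: linear_sum[OF linear_Re_cinner_matrix])
  then show "(\<Sum>l\<in>UNIV. Re (cinner (e j) (P l *v e j))) = 1"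
    using P e by (simp add: povm_def orthonormal_family_def)
qed

section \<open>The classical data processing inequality\<close>

text \<open>If \<open>p\<close> and the rows of \<open>a\<close> are probability vectors,
  \<open>q\<close> and \<open>s\<close> are the laws of \<open>J\<close> and \<open>Y\<close>,
  \<open>c\<close> is the conditional law of \<open>Y\<close> given \<open>X\<close>, and the two
  sides are I(X:Y) and I(X:J) as expected log ratios.\<close>

lemma data_processing_inequality:
  fixes p :: "'k::finite \<Rightarrow> real" and a :: "'k \<Rightarrow> 'j::finite \<Rightarrow> real" and t :: "'j \<Rightarrow> 'm::finite \<Rightarrow> real"
  assumes b: "1 < b"
    and p: "\<And>i. 0 \<le> p i"
    and a: "\<And>i j. 0 \<le> a i j"
    and t: "\<And>j l. 0 \<le> t j l" "\<And>j. (\<Sum>l\<in>UNIV. t j l) = 1"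
  defines "q \<equiv> \<lambda>j. \<Sum>i\<in>UNIV. p i * a i j"
    and "c \<equiv> \<lambda>i l. \<Sum>j\<in>UNIV. a i j * t j l"
    and "s \<equiv> \<lambda>l. \<Sum>i\<in>UNIV. p i * (\<Sum>j\<in>UNIV. a i j * t j l)"
  shows "(\<Sum>i\<in>UNIV. \<Sum>l\<in>UNIV. p i * c i l * (log b (c i l) - log b (s l)))
    \<le> (\<Sum>i\<in>UNIV. \<Sum>j\<in>UNIV. p i * a i j * (log b (a i j) - log b (q j)))"
proof -
  have c0: "0 \<le> c i l" for i l
    unfolding c_def by (intro sum_nonneg mult_nonneg_nonneg a t)
  have q0: "0 \<le> q j" for j
    unfolding q_def by (intro sum_nonneg mult_nonneg_nonneg a p)
  have s_c: "s l = (\<Sum>i\<in>UNIV. p i * c i l)" for l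
    by (simp add: s_def c_def)
  have s0: "0 \<le> s l" for l
    unfolding s_c by (intro sum_nonneg mult_nonneg_nonneg c0 p)
  have s_q: "(\<Sum>j\<in>UNIV. q j * t j l) = s l" for l
    unfolding s_def q_def sum_distrib_right sum_distrib_left
    by (subst sum.swap) (simp add: mult_ac)
  define w where "w i j l = p i * a i j * t j l" for i j l
  have w0: "0 \<le> w i j l" for i j l
    unfolding w_def by (intro mult_nonneg_nonneg p a t)
  have w_l: "(\<Sum>l\<in>UNIV. w i j l) = p i * a i j" for i j
    by (simp add: w_def t flip: sum_distrib_left)
  have w_j: "(\<Sum>j\<in>UNIV. w i j l) = p i * c i l" for i l
    by (simp add: w_def c_def sum_distrib_left mult.assoc)
  \<comment> \<open>This is 1 - x \<le> - ln x multiplied by \<open>w i j l\<close>, where x =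
    \<open>q j * c i l / (a i j * s l)\<close>. The factor \<open>a i j\<close> is cancelled in the
    subtracted term, so the term makes sense and is nonnegative also where the weight
    vanishes.\<close>
  have pointwise: "w i j l - p i * c i l * (q j * t j l) / s l
      \<le> w i j l * (ln (a i j) - ln (q j)) - w i j l * (ln (c i l) - ln (s l))" for i j l
  proof (cases "w i j l = 0")
    case True
    have "0 \<le> p i * c i l * (q j * t j l) / s l"
      by (intro divide_nonneg_nonneg mult_nonneg_nonneg p c0 q0 t s0)
    then show ?thesis
      by (simp add: True)
  next
    case False
    then have pos: "0 < p i" "0 < a i j" "0 < t j l" "0 < w i j l"
      using p[of i] a[of i j] t(1)[of j l] w0[of i j l] by (auto simp: w_def)
    have "0 < a i j * t j l"
      using pos by simp
    also have "\<dots> \<le> c i l"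
      unfolding c_def by (intro member_le_sum) (auto intro!: mult_nonneg_nonneg a t)
    finally have c: "0 < c i l" .
    have "0 < p i * a i j"
      using pos by simp
    also have "\<dots> \<le> q j"
      unfolding q_def by (intro member_le_sum) (auto intro!: mult_nonneg_nonneg a p)
    finally have q: "0 < q j" .
    have "0 < p i * c i l"
      using pos c by simp
    also have "\<dots> \<le> s l"
      unfolding s_c by (intro member_le_sum) (auto intro!: mult_nonneg_nonneg c0 p)
    finally have s: "0 < s l" .
    have "ln (q j * c i l / (a i j * s l)) \<le> q j * c i l / (a i j * s l) - 1"
      using q c s pos by (intro ln_le_minus_one) simp
    then have "1 - q j * c i l / (a i j * s l) \<le> ln (a i j) - ln (q j) - (ln (c i l) - ln (s l))"
      using q c s pos by (simp add: ln_mult ln_div)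
    from mult_left_mono[OF this w0[of i j l]]
    have "w i j l - w i j l * (q j * c i l / (a i j * s l))
        \<le> w i j l * (ln (a i j) - ln (q j)) - w i j l * (ln (c i l) - ln (s l))"
      by (simp add: algebra_simps)
    moreover have "w i j l * (q j * c i l / (a i j * s l)) = p i * c i l * (q j * t j l) / s l"
      using pos by (simp add: w_def)
    ultimately show ?thesis
      by simp
  qed
  \<comment> \<open>\<open>A\<close> and \<open>B\<close> integrate out \<open>l\<close> and
    \<open>j\<close> respectively from the joint weight \<open>w\<close>.\<close>
  have A: "(\<Sum>i\<in>UNIV. \<Sum>j\<in>UNIV. \<Sum>l\<in>UNIV. w i j l * f i j) = (\<Sum>i\<in>UNIV. \<Sum>j\<in>UNIV. p i * a i j * f i j)" for f
    by (simp add: w_l flip: sum_distrib_right)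
  have B: "(\<Sum>i\<in>UNIV. \<Sum>j\<in>UNIV. \<Sum>l\<in>UNIV. w i j l * f i l) = (\<Sum>i\<in>UNIV. \<Sum>l\<in>UNIV. p i * c i l * f i l)" for f
    by (subst sum.swap[of _ UNIV UNIV]) (simp add: w_j flip: sum_distrib_right)
  have "(\<Sum>i\<in>UNIV. \<Sum>j\<in>UNIV. \<Sum>l\<in>UNIV. p i * c i l * (q j * t j l) / s l)
      = (\<Sum>i\<in>UNIV. \<Sum>l\<in>UNIV. p i * c i l * s l / s l)"
    by (subst sum.swap[of _ UNIV UNIV]) (simp add: s_q flip: sum_distrib_left sum_divide_distrib)
  \<comment> \<open>The quotient \<open>s l / s l\<close> is 1, or 0 if \<open>s l = 0\<close>; an
    inequality covers both cases.\<close>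
  also have "\<dots> \<le> (\<Sum>i\<in>UNIV. \<Sum>l\<in>UNIV. p i * c i l)"
    by (intro sum_mono) (auto intro: mult_nonneg_nonneg p c0)
  also have "\<dots> = (\<Sum>i\<in>UNIV. \<Sum>j\<in>UNIV. \<Sum>l\<in>UNIV. w i j l)"
    using B[of "\<lambda>_ _. 1"] by simp
  finally have "0 \<le> (\<Sum>i\<in>UNIV. \<Sum>j\<in>UNIV. \<Sum>l\<in>UNIV. w i j l - p i * c i l * (q j * t j l) / s l)"
    by (simp add: sum_subtractf)
  also have "\<dots> \<le> (\<Sum>i\<in>UNIV. \<Sum>j\<in>UNIV. \<Sum>l\<in>UNIV.
      w i j l * (ln (a i j) - ln (q j)) - w i j l * (ln (c i l) - ln (s l)))"
    by (intro sum_mono pointwise)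
  also have "\<dots> = (\<Sum>i\<in>UNIV. \<Sum>j\<in>UNIV. p i * a i j * (ln (a i j) - ln (q j)))
      - (\<Sum>i\<in>UNIV. \<Sum>l\<in>UNIV. p i * c i l * (ln (c i l) - ln (s l)))"
    unfolding sum_subtractf A B ..
  finally have "(\<Sum>i\<in>UNIV. \<Sum>l\<in>UNIV. p i * c i l * (ln (c i l) - ln (s l))) / ln b
      \<le> (\<Sum>i\<in>UNIV. \<Sum>j\<in>UNIV. p i * a i j * (ln (a i j) - ln (q j))) / ln b"
    using b by (intro divide_right_mono) auto
  then show ?thesis
    by (simp add: log_def sum_divide_distrib flip: diff_divide_distrib)
qed

section \<open>Entropies of finite-valued random variables\<close>

text \<open>Values that \<open>X\<close> never takes have probability 0 and contribute 0, so the sum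
  can run over the whole type.\<close>

lemma shannon_entropy_finite:
  fixes X :: "'w \<Rightarrow> 'a::finite"
  assumes "prob_space M" and b: "1 < b" and X: "X \<in> M \<rightarrow>\<^sub>M count_space UNIV"
    and f: "\<And>x. measure M {\<omega>\<in>space M. X \<omega> = x} = f x"
  shows "shannon_entropy b M X = - (\<Sum>x\<in>UNIV. f x * log b (f x))"
proof -
  interpret information_space M b
    using assms by (simp add: information_space_def information_space_axioms_def)
  have X_eq: "X -` {x} \<inter> space M = {\<omega>\<in>space M. X \<omega> = x}" for x
    by auto
  have f_nonneg: "0 \<le> f x" for x
    by (simp flip: f)
  have "simple_function M X"
    unfolding simple_function_def using measurable_sets[OF X] by auto
  then have "simple_distributed M X f"
    by (rule simple_distributedI) (simp_all add: X_eq f f_nonneg)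
  then have "shannon_entropy b M X = - (\<Sum>x\<in>X ` space M. f x * log b (f x))"
    unfolding shannon_entropy_def by (rule entropy_simple_distributed)
  moreover have "f x = 0" if "x \<notin> X ` space M" for x
  proof -
    have "{\<omega>\<in>space M. X \<omega> = x} = {}"
      using that by auto
    then show ?thesis
      by (metis f measure_empty)
  qed
  then have "(\<Sum>x\<in>X ` space M. f x * log b (f x)) = (\<Sum>x\<in>UNIV. f x * log b (f x))"
    by (intro sum.mono_neutral_left) auto
  ultimately show ?thesis
    by simp
qed

text \<open>The fibres of \<open>X\<close> partition \<open>A\<close>. Taking \<open>A\<close> to be
  the whole space or an event of another variable gives normalization and marginal laws.\<close>

lemma sum_measure_fibres:
  fixes X :: "'w \<Rightarrow> 'a::finite"
  assumes "finite_measure M" and X: "X \<in> M \<rightarrow>\<^sub>M count_space UNIV" and A: "A \<in> sets M"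
  shows "(\<Sum>x\<in>UNIV. measure M {\<omega>\<in>A. X \<omega> = x}) = measure M A"
proof -
  interpret finite_measure M by fact
  have A_eq: "{\<omega>\<in>A. X \<omega> = x} = X -` {x} \<inter> space M \<inter> A" for x
    using sets.sets_into_space[OF A] by auto
  have "{\<omega>\<in>A. X \<omega> = x} \<in> sets M" for x
    unfolding A_eq using measurable_sets[OF X] A by auto
  then have "(\<Sum>x\<in>UNIV. measure M {\<omega>\<in>A. X \<omega> = x}) = measure M (\<Union>x\<in>UNIV. {\<omega>\<in>A. X \<omega> = x})"
    by (intro finite_measure_finite_Union[symmetric]) (auto simp: disjoint_family_on_def)
  also have "(\<Union>x\<in>UNIV. {\<omega>\<in>A. X \<omega> = x}) = A"
    by auto
  finally show ?thesis .
qed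

text \<open>The logarithm of the joint law splits, and its \<open>log b (p i)\<close> part cancels
  the entropy of \<open>X\<close>.\<close>

lemma shannon_mutual_info_finite:
  fixes X :: "'w \<Rightarrow> 'k::finite" and Y :: "'w \<Rightarrow> 'm::finite"
  assumes M: "prob_space M" and b: "1 < b"
    and X: "X \<in> M \<rightarrow>\<^sub>M count_space UNIV" and Y: "Y \<in> M \<rightarrow>\<^sub>M count_space UNIV"
    and p: "\<And>i. measure M {\<omega>\<in>space M. X \<omega> = i} = p i"
    and pc: "\<And>i l. measure M {\<omega>\<in>space M. X \<omega> = i \<and> Y \<omega> = l} = p i * c i l"
    and c0: "\<And>i l. 0 \<le> c i l"
  defines "s \<equiv> \<lambda>l. \<Sum>i\<in>UNIV. p i * c i l"
  shows "shannon_mutual_info b M X Y = (\<Sum>i\<in>UNIV. \<Sum>l\<in>UNIV. p i * c i l * (log b (c i l) - log b (s l)))"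
proof -
  interpret prob_space M by fact
  have s: "measure M {\<omega>\<in>space M. Y \<omega> = l} = s l" for l
  proof -
    have "{\<omega>\<in>space M. Y \<omega> = l} = Y -` {l} \<inter> space M"
      by auto
    then have "{\<omega>\<in>space M. Y \<omega> = l} \<in> sets M"
      using measurable_sets[OF Y] by auto
    from sum_measure_fibres[OF finite_measure_axioms X this]
    show ?thesis
      by (simp add: s_def conj_ac flip: pc)
  qed
  have XY: "(\<lambda>\<omega>. (X \<omega>, Y \<omega>)) \<in> M \<rightarrow>\<^sub>M count_space UNIV"
    using measurable_Pair[OF X Y] by (simp add: pair_measure_countable)
  \<comment> \<open>The joint law says nothing about \<open>c i\<close> when \<open>p i = 0\<close>,
    so the row sum is stated with the factor \<open>p i\<close>.\<close>
  have c: "(\<Sum>l\<in>UNIV. p i * c i l) = p i" for i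
  proof -
    have "{\<omega>\<in>space M. X \<omega> = i} = X -` {i} \<inter> space M"
      by auto
    then have "{\<omega>\<in>space M. X \<omega> = i} \<in> sets M"
      using measurable_sets[OF X] by auto
    from sum_measure_fibres[OF finite_measure_axioms Y this]
    show ?thesis
      by (simp add: p flip: pc)
  qed
  \<comment> \<open>The row sum is inserted backwards to write the entropy of \<open>X\<close> over
    the same index pairs as the joint entropy.\<close>
  have HX: "shannon_entropy b M X = - (\<Sum>i\<in>UNIV. \<Sum>l\<in>UNIV. p i * c i l * log b (p i))"
    by (simp add: shannon_entropy_finite[OF M b X p] c flip: sum_distrib_right)
  have HY: "shannon_entropy b M Y = - (\<Sum>i\<in>UNIV. \<Sum>l\<in>UNIV. p i * c i l * log b (s l))"
    unfolding shannon_entropy_finite[OF M b Y s]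
    by (subst sum.swap) (simp add: s_def sum_distrib_right)
  have "measure M {\<omega>\<in>space M. (X \<omega>, Y \<omega>) = z} = (case z of (i, l) \<Rightarrow> p i * c i l)" for z
    by (cases z) (simp add: pc)
  from shannon_entropy_finite[OF M b XY this]
  have HXY: "shannon_entropy b M (\<lambda>\<omega>. (X \<omega>, Y \<omega>)) =
      - (\<Sum>i\<in>UNIV. \<Sum>l\<in>UNIV. p i * c i l * log b (p i * c i l))"
    by (simp add: sum.cartesian_product case_prod_unfold)
  have "p i * c i l * (log b (c i l) - log b (s l)) =
      p i * c i l * log b (p i * c i l) - p i * c i l * log b (p i) - p i * c i l * log b (s l)" for i l
  proof (cases "p i * c i l = 0")
    case False
    have "0 \<le> p i"
      by (simp flip: p)
    then have "log b (p i * c i l) = log b (p i) + log b (c i l)"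
      using False c0[of i l] by (intro log_mult_pos) auto
    then show ?thesis
      by (simp add: algebra_simps)
  qed auto
  then show ?thesis
    by (simp add: shannon_mutual_info_def HX HY HXY sum_subtractf)
qed

theorem theorem4:
  fixes V W :: "'k::finite \<Rightarrow> complex ^ 'n::finite ^ 'n"
    and \<mu> :: "(complex ^ 'n ^ 'n) measure"
    and \<rho>\<^sub>W :: "complex ^ 'n ^ 'n"
    and e :: "'k \<Rightarrow> complex ^ 'k"
    and p :: "'k \<Rightarrow> real"
    and \<sigma> :: "'k \<Rightarrow> complex ^ 'k ^ 'k"
    and \<rho> :: "complex ^ 'k ^ 'k"
    and P :: "'m::finite \<Rightarrow> complex ^ 'k ^ 'k"
    and M :: "'w measure"
    and X :: "'w \<Rightarrow> 'k"
    and Y :: "'w \<Rightarrow> 'm"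
    and b :: real
  assumes "1 < b"
    and "qifs_well_defined V"
    and "(\<Sum>i\<in>UNIV. cadj (W i) ** W i) = mat 1"
    and "attractive_invariant V W \<mu>"
    and "\<And>\<mu>'. attractive_invariant V W \<mu>' \<Longrightarrow> \<mu>' = \<mu>"
    and "\<rho>\<^sub>W = barycenter \<mu>"
    and "\<And>i. p i = tr_conj (W i) \<rho>\<^sub>W"
    and "orthonormal_family e"
    and "\<And>i. \<sigma> i = (\<Sum>j\<in>UNIV. qifs_trans V W i j \<rho>\<^sub>W *\<^sub>R ketbra (e j) (e j))"
    and "povm P"
    and "measured_ensemble M X Y p \<sigma> P"
    and "\<rho> = (\<Sum>i\<in>UNIV. p i *\<^sub>R \<sigma> i)"
  shows "shannon_mutual_info b M X Y \<le> von_neumann_entropy b \<rho> - qifs_entropy b V W \<rho>\<^sub>W"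
proof -
  have M: "prob_space M" and X: "X \<in> M \<rightarrow>\<^sub>M count_space UNIV" and Y: "Y \<in> M \<rightarrow>\<^sub>M count_space UNIV"
    and pX: "\<And>i. measure M {\<omega>\<in>space M. X \<omega> = i} = p i"
    and pXY: "\<And>i l. measure M {\<omega>\<in>space M. X \<omega> = i \<and> Y \<omega> = l} = p i * Re (trace (P l ** \<sigma> i))"
    using assms(11) by (auto simp: measured_ensemble_def)
  interpret prob_space M by fact
  \<comment> \<open>The trace of the barycenter is read off from the law of \<open>X\<close>: the
    \<open>p i\<close> are its point probabilities, and completeness of \<open>W\<close> identifies
    their sum with the trace.\<close>
  have "(\<Sum>i\<in>UNIV. p i) = 1"
    using sum_measure_fibres[OF finite_measure_axioms X sets.top] by (simp add: pX prob_space)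
  then have tr: "Re (trace \<rho>\<^sub>W) = 1"
    by (simp add: assms(7) sum_tr_conj[OF assms(3)])
  \<comment> \<open>The Bochner integral of a non-integrable function is \<open>0\<close>, which has trace \<open>0\<close>.\<close>
  have "integrable \<mu> (\<lambda>\<rho>. \<rho>)"
  proof (rule ccontr)
    assume "\<not> integrable \<mu> (\<lambda>\<rho>. \<rho>)"
    then have "\<rho>\<^sub>W = 0"
      by (simp add: assms(6) barycenter_def not_integrable_integral_eq)
    with tr show False
      by (simp add: trace_def)
  qed
  then have psd: "psd \<rho>\<^sub>W"
    using assms(4,6) by (simp add: attractive_invariant_def psd_barycenter)
  define a where "a i j = qifs_trans V W i j \<rho>\<^sub>W" for i j
  define t where "t j l = Re (cinner (e j) (P l *v e j))" for j l
  define q where "q j = (\<Sum>i\<in>UNIV. p i * a i j)" for j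
  define c where "c i l = (\<Sum>j\<in>UNIV. a i j * t j l)" for i l
  have p0: "0 \<le> p i" for i
    by (simp flip: pX)
  have a0: "0 \<le> a i j" for i j
    using psd by (simp add: a_def qifs_trans_nonneg)
  have t0: "0 \<le> t j l" and t1: "(\<Sum>l\<in>UNIV. t j l) = 1" for j l
    using povm_distribution[OF assms(10,8)] by (simp_all add: t_def)
  have c0: "0 \<le> c i l" for i l
    unfolding c_def by (intro sum_nonneg mult_nonneg_nonneg a0 t0)
  have "Re (trace (P l ** \<sigma> i)) = c i l" for i l
    by (simp add: assms(9) Re_trace_mul_sum_ketbra c_def a_def t_def)
  then have "shannon_mutual_info b M X Y =
      (\<Sum>i\<in>UNIV. \<Sum>l\<in>UNIV. p i * c i l * (log b (c i l) - log b (\<Sum>i\<in>UNIV. p i * c i l)))"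
    using pXY c0 by (intro shannon_mutual_info_finite M assms(1) X Y pX) auto
  also have "\<dots> \<le> (\<Sum>i\<in>UNIV. \<Sum>j\<in>UNIV. p i * a i j * (log b (a i j) - log b (q j)))"
    unfolding c_def q_def by (intro data_processing_inequality assms(1) p0 a0 t0 t1)
  \<comment> \<open>Splitting the logarithm separates I(X:J) into
    \<open>- qifs_entropy b V W \<rho>\<^sub>W\<close> and the entropy of \<open>q\<close>.\<close>
  also have "\<dots> = (\<Sum>i\<in>UNIV. \<Sum>j\<in>UNIV. p i * a i j * log b (a i j))
      - (\<Sum>i\<in>UNIV. \<Sum>j\<in>UNIV. p i * a i j * log b (q j))"
    by (simp add: right_diff_distrib sum_subtractf)
  also have "(\<Sum>i\<in>UNIV. \<Sum>j\<in>UNIV. p i * a i j * log b (q j)) = (\<Sum>j\<in>UNIV. q j * log b (q j))"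
    by (subst sum.swap) (simp add: q_def sum_distrib_right)
  also have "(\<Sum>i\<in>UNIV. \<Sum>j\<in>UNIV. p i * a i j * log b (a i j)) = - qifs_entropy b V W \<rho>\<^sub>W"
    by (simp add: qifs_entropy_def a_def assms(7) mult.assoc)
  \<comment> \<open>All \<open>\<sigma> i\<close> share the basis \<open>e\<close>, so averaging
    them averages eigenvalues and \<open>\<rho>\<close> has spectrum \<open>q\<close>. This identity
    only feeds the next one, which is the actual link of the calculation.\<close>
  also have "\<rho> = (\<Sum>j\<in>UNIV. q j *\<^sub>R ketbra (e j) (e j))"
    unfolding assms(12) assms(9) q_def scaleR_sum_right scaleR_sum_left
    by (subst sum.swap) (simp add: a_def)
  then have "(\<Sum>j\<in>UNIV. q j * log b (q j)) = - von_neumann_entropy b \<rho>"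
    by (simp add: von_neumann_entropy_diag[OF assms(8)])
  finally show ?thesis
    by simp
qed

end
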